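(* Let $p$ be a prime, let $m\mid p-1$ be even, and let $k\ge1$ be an integer. Then \[ M_{2k}(p,m)=\frac{2\pi^{2k}}{p^k}\sum_{\lambda\in\mathcal{G}_m}\ \sum_{t_1,\ldots,t_{k-1}=1}^{p-1}\mathsf{s}(t_1,p)\cdots\mathsf{s}(t_{k-1},p)\,\mathsf{s}(\lambda t_1\cdots t_{k-1},p), \] where for $k=1$ the inner sum is to be read as $\mathsf{s}(\lambda,p)$.
   Context: $\mathcal{G}_m$ is the unique subgroup of $\mathbb{F}_p^*$ of index $m$, whose elements are identified with integer representatives; $\mathcal{X}_{p,m}$ is the group of multiplicative characters of $\mathbb{F}_p^*$ trivial on $\mathcal{G}_m$, $\mathcal{X}_{p,m}^-=\{\chi\in\mathcal{X}_{p,m}:\chi(-1)=-1\}$, $L(1,\chi)=\sum_{n\ge1}\chi(n)/n$, and $M_\nu(p,m)=\frac{2}{m}\sum_{\chi\in\mathcal{X}_{p,m}^-}|L(1,\chi)|^\nu$. The Dedekind sum is $\mathsf{s}(c,q)=\sum_{a=1}^{q-1}((a/q))((ac/q))$ with $((\xi))=\{\xi\}-1/2$ for $\xi\notin\mathbb{Z}$ and $((\xi))=0$ for $\xi\in\mathbb{Z}$; $\mathsf{s}(c,p)$ depends only on $c$ modulo $p$. *)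

theory Defs
  imports
    Complex_Main
    "HOL-Library.FuncSet"
    "HOL-Number_Theory.Residues"
begin

abbreviation Fp_units :: "nat \<Rightarrow> int monoid"
  where "Fp_units p \<equiv> mult_of (residue_ring (int p))"

definition Complex_units :: "complex monoid"
  where "Complex_units = \<lparr>carrier = UNIV - {0}, monoid.mult = (*), one = 1\<rparr>"

text \<open>
  The elements of \<open>Fp_units p\<close>, hence those of its subgroups, are the integers
  \<open>1, ..., p - 1\<close> themselves, so they can be used directly as integer representatives.
  The lemma \<open>ex1_index_subgroup\<close> below shows that the description is proper.
\<close>

definition index_subgroup :: "nat \<Rightarrow> nat \<Rightarrow> int set"
  where "index_subgroup p m =
    (THE H. subgroup H (Fp_units p) \<and> card (rcosets\<^bsub>Fp_units p\<^esub> H) = m)"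

text \<open>
  Elements of \<open>hom\<close> are unconstrained outside the carrier; requiring extensionality makes each
  character a single HOL function, so that sums over sets of characters are meaningful.
\<close>

definition mult_characters :: "nat \<Rightarrow> (int \<Rightarrow> complex) set"
  where "mult_characters p = hom (Fp_units p) Complex_units \<inter> extensional (carrier (Fp_units p))"

definition characters_mod_index :: "nat \<Rightarrow> nat \<Rightarrow> (int \<Rightarrow> complex) set"
  where "characters_mod_index p m =
    {\<chi> \<in> mult_characters p. \<forall>a \<in> index_subgroup p m. \<chi> a = 1}"

text \<open>The usual extension of a character to all integers: \<open>p\<close>-periodic, and zero on multiples of \<open>p\<close>.\<close>

definition char_int :: "nat \<Rightarrow> (int \<Rightarrow> complex) \<Rightarrow> int \<Rightarrow> complex"
  where "char_int p \<chi> n = (if int p dvd n then 0 else \<chi> (n mod int p))"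

definition odd_characters_mod_index :: "nat \<Rightarrow> nat \<Rightarrow> (int \<Rightarrow> complex) set"
  where "odd_characters_mod_index p m = {\<chi> \<in> characters_mod_index p m. char_int p \<chi> (-1) = -1}"

definition L_one :: "nat \<Rightarrow> (int \<Rightarrow> complex) \<Rightarrow> complex"
  where "L_one p \<chi> = (\<Sum>n. char_int p \<chi> (int (Suc n)) / of_nat (Suc n))"

definition L_moment :: "nat \<Rightarrow> nat \<Rightarrow> nat \<Rightarrow> real"
  where "L_moment \<nu> p m =
    2 / real m * (\<Sum>\<chi>\<in>odd_characters_mod_index p m. cmod (L_one p \<chi>) ^ \<nu>)"

definition sawtooth :: "real \<Rightarrow> real"
  where "sawtooth \<xi> = (if \<xi> \<in> \<int> then 0 else frac \<xi> - 1 / 2)"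

definition dedekind_sum :: "int \<Rightarrow> nat \<Rightarrow> real"
  where "dedekind_sum c q =
    (\<Sum>a = 1..q - 1. sawtooth (real a / real q) * sawtooth (real a * real_of_int c / real q))"

lemma ex1_index_subgroup:
  assumes p: "prime p" and m: "m dvd p - 1"
  shows "\<exists>!H. subgroup H (Fp_units p) \<and> card (rcosets\<^bsub>Fp_units p\<^esub> H) = m"
proof -
  interpret R: residues_prime p "residue_ring (int p)"
    by unfold_locales (use p in auto)
  interpret G: group "Fp_units p" by (rule R.field_mult_group)
  have finR: "finite (carrier (residue_ring (int p)))" by simp
  have finG: "finite (carrier (Fp_units p))" using finR by simp
  have ord: "order (Fp_units p) = p - 1"
    using R.order_mult_of[OF finR] by (simp add: order_def R.res_carrier_eq)
  have p1: "p - 1 > 0" using prime_gt_1_nat[OF p] by simp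
  define d where "d = (p - 1) div m"
  have md: "m * d = p - 1" using m by (simp add: d_def)
  have d0: "d > 0" and m0: "m > 0" using md p1 by (auto intro!: Nat.gr0I)
  have card_iff: "card (rcosets\<^bsub>Fp_units p\<^esub> H) = m \<longleftrightarrow> card H = d"
    if H: "subgroup H (Fp_units p)" for H
  proof -
    have eq: "card (rcosets\<^bsub>Fp_units p\<^esub> H) * card H = m * d"
      using G.lagrange_finite[OF finG H] ord md by simp
    then show ?thesis using d0 m0 by (metis mult_cancel1 mult_cancel2 less_irrefl)
  qed
  let ?K = "{x \<in> carrier (residue_ring (int p)). x [^]\<^bsub>residue_ring (int p)\<^esub> d = \<one>\<^bsub>residue_ring (int p)\<^esub>}"
  have cardK: "card ?K \<le> d" by (rule R.num_roots_le_deg[OF finR]) (use d0 in auto)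
  have uniq: "H = ?K" if H: "subgroup H (Fp_units p)" "card H = d" for H
  proof (rule card_seteq)
    show "H \<subseteq> ?K"
    proof
      fix x assume x: "x \<in> H"
      interpret S: group "Fp_units p\<lparr>carrier := H\<rparr>"
        by (rule G.subgroup_imp_group[OF H(1)])
      have "x [^]\<^bsub>Fp_units p\<lparr>carrier := H\<rparr>\<^esub> order (Fp_units p\<lparr>carrier := H\<rparr>) = \<one>\<^bsub>Fp_units p\<lparr>carrier := H\<rparr>\<^esub>"
        by (rule S.pow_order_eq_1) (use x in simp)
      then have "x [^]\<^bsub>Fp_units p\<^esub> d = \<one>\<^bsub>Fp_units p\<^esub>"
        using H(2) by (simp add: order_def nat_pow_def)
      then show "x \<in> ?K" using subgroup.subset[OF H(1)] x
        by (auto simp: nat_pow_mult_of)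
    qed
    show "finite ?K" using finR by simp
    show "card ?K \<le> card H" using cardK H(2) by simp
  qed
  obtain a where a: "a \<in> carrier (Fp_units p)"
    and gen: "carrier (Fp_units p) = {a [^]\<^bsub>residue_ring (int p)\<^esub> i | i::nat. i \<in> UNIV}"
    using R.finite_field_mult_group_has_gen[OF finR] by blast
  have orda: "G.ord a = p - 1"
  proof -
    have "generate (Fp_units p) {a} = carrier (Fp_units p)"
      using G.generate_pow_on_finite_carrier[OF finG a] gen by (simp only: nat_pow_mult_of)
    then show ?thesis using G.generate_pow_card[OF a] ord by (simp add: order_def)
  qed
  let ?b = "a [^]\<^bsub>Fp_units p\<^esub> m"
  have b: "?b \<in> carrier (Fp_units p)" using a by (rule G.nat_pow_closed)
  have ordb: "G.ord ?b = d"
    using G.ord_pow_gen[OF a, of m] orda m0 m by (simp add: d_def gcd_nat.absorb2)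
  have sub: "subgroup (generate (Fp_units p) {?b}) (Fp_units p)"
    using b by (intro G.generate_is_subgroup) auto
  have card_gen: "card (generate (Fp_units p) {?b}) = d"
    using G.generate_pow_card[OF b] ordb by simp
  have "subgroup (generate (Fp_units p) {?b}) (Fp_units p) \<and>
      card (rcosets\<^bsub>Fp_units p\<^esub> generate (Fp_units p) {?b}) = m"
    using card_iff[OF sub] card_gen sub by simp
  then show ?thesis
  proof (rule ex1I)
    fix H assume "subgroup H (Fp_units p) \<and> card (rcosets\<^bsub>Fp_units p\<^esub> H) = m"
    then have "H = ?K" using uniq[of H] card_iff[of H] by simp
    also have "\<dots> = generate (Fp_units p) {?b}" using uniq[OF sub card_gen] by simp
    finally show "H = generate (Fp_units p) {?b}" .
  qed
qed

end

(*
  For odd chi, inserting the Fourier series ((y)) = -(1/pi) sum_n sin(2 pi n y)/n into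
  B(chi) = sum_a chi(a) ((a/p)) and evaluating the inner sums as Gauss sums of modulus sqrt p
  gives |L(1,chi)|^2 = (pi^2/p) |B(chi)|^2. Substituting ac for c in the Dedekind sum shows
  |B(chi)|^2 = D(chi) with D(chi) = sum_c chi(c) s(c,p), and D(chi) = 0 for even chi because s is
  odd in c. So the moment is a sum of D(chi)^k over all characters trivial on G_m. Expanding the
  power, orthogonality restricts the last variable c to c t_1 ... t_(k-1) in G_m, and
  s(c,p) = s(1/c,p) turns this into the sum over lambda.
*)
theory Submission
  imports Defs "HOL-Number_Theory.Residue_Primitive_Roots"
begin

section \<open>Fourier series of the sawtooth function\<close>

text \<open>\<open>L_one\<close> is the value of a conditionally convergent series, so convergence
  has to come along with the evaluation. Both follow from the sine series at the finitely many
  points a/p, for which pointwise convergence suffices; it comes from an explicit O(1/N) error at a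
  fixed point. On the algebraic side the subgroup and the characters are given only abstractly. A
  primitive root g makes them explicit: with d = (p - 1)/m, G_m is {x : x^d = 1}, the set of powers
  of g^m, and chi is encoded by chi(g), an arbitrary m-th root of unity. Orthogonality is then a
  geometric sum. The coset condition gives c = h u^(-1) with h in G_m and u = t_1 ... t_(k-1),
  whereas the theorem has h u; the inversion symmetry of s closes this gap. In the constant, each
  |L(1,chi)|^2 contributes pi^2/p, and the factor m from orthogonality cancels against the
  normalization 2/m.\<close>

lemma dirichlet_kernel:
  fixes x :: real
  shows "2 * sin (x / 2) * (1 / 2 + (\<Sum>n<N. cos (real (Suc n) * x))) = sin ((real N + 1 / 2) * x)"
proof (induction N)
  case (Suc N)
  \<comment> \<open>Each new cosine, multiplied by \<open>2 * sin (x / 2)\<close>, is a difference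
    of consecutive right-hand sides, so the sum telescopes.\<close>
  have "sin ((real (Suc N) + 1 / 2) * x) - sin ((real N + 1 / 2) * x) =
      2 * sin (x / 2) * cos (real (Suc N) * x)"
  proof -
    have "((real (Suc N) + 1 / 2) * x - (real N + 1 / 2) * x) / 2 = x / 2"
      and "((real (Suc N) + 1 / 2) * x + (real N + 1 / 2) * x) / 2 = real (Suc N) * x"
      by (simp_all add: field_simps)
    then show ?thesis by (simp only: sin_diff_sin)
  qed
  then show ?case using Suc by (simp add: algebra_simps)
qed simp

text \<open>The partial sum minus its limit has the Dirichlet kernel sin(M t)/(2 sin(t/2)) as
  derivative, and an integration by parts gains the factor 1/M. For \<open>x \<le> pi\<close> the
  function sin(t/2) increases on [x, pi], so its value at x serves as lower bound
  throughout.\<close>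

lemma sin_series_partial_sum_bound:
  fixes x :: real
  assumes x: "0 < x" "x \<le> pi"
  shows "\<bar>(\<Sum>n<N. sin (real (Suc n) * x) / real (Suc n)) - (pi - x) / 2\<bar>
      \<le> (1 / sin (x / 2) + pi / (2 * sin (x / 2) ^ 2)) * inverse (real (Suc N))"
proof -
  define M where "M = real N + 1 / 2"
  \<comment> \<open>The cosine term cancels the leading part of the derivative (the Dirichlet kernel), so
    \<open>E'\<close> is of order \<open>1 / M\<close> and the mean value theorem on \<open>[x, pi]\<close> applies.\<close>
  define E where "E t = (\<Sum>n<N. sin (real (Suc n) * t) / real (Suc n)) - (pi - t) / 2
      + cos (M * t) / (2 * M * sin (t / 2))" for t :: real
  define E' where "E' t = - cos (M * t) * cos (t / 2) / (4 * M * sin (t / 2) ^ 2)" for t :: real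
  have M: "M > 0" by (simp add: M_def)
  have sinpos: "sin (t / 2) > 0" if "x \<le> t" "t \<le> pi" for t
    using that x by (intro sin_gt_zero) auto
  have sinmono: "sin (x / 2) \<le> sin (t / 2)" if "x \<le> t" "t \<le> pi" for t
    using that x by (intro sin_monotone_2pi_le) auto
  have deriv: "(E has_real_derivative E' t) (at t)" if t: "x \<le> t" "t \<le> pi" for t
  proof -
    have "1 / 2 + (\<Sum>n<N. cos (real (Suc n) * t)) = sin (M * t) / (2 * sin (t / 2))"
      using dirichlet_kernel[of t N] sinpos[OF t] by (simp add: M_def field_simps)
    moreover have "(E has_real_derivative ((\<Sum>n<N. cos (real (Suc n) * t)) + 1 / 2 +
        (- (M * sin (M * t)) * (2 * M * sin (t / 2)) - cos (M * t) * (M * cos (t / 2))) /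
          (2 * M * sin (t / 2)) ^ 2)) (at t)"
      unfolding E_def using sinpos[OF t] M
      by (auto intro!: derivative_eq_intros simp del: of_nat_Suc simp: power2_eq_square algebra_simps)
    ultimately have "(E has_real_derivative (sin (M * t) / (2 * sin (t / 2)) +
        (- (M * sin (M * t)) * (2 * M * sin (t / 2)) - cos (M * t) * (M * cos (t / 2))) /
          (2 * M * sin (t / 2)) ^ 2)) (at t)"
      by (simp add: add.commute)
    moreover have "(sin (M * t) / (2 * sin (t / 2)) +
        (- (M * sin (M * t)) * (2 * M * sin (t / 2)) - cos (M * t) * (M * cos (t / 2))) /
          (2 * M * sin (t / 2)) ^ 2) = E' t"
      using sinpos[OF t] M by (simp add: E'_def power2_eq_square field_simps)
    ultimately show ?thesis by simp
  qed
  have bound: "\<bar>E' t\<bar> \<le> 1 / (4 * M * sin (x / 2) ^ 2)" if t: "x \<le> t" "t \<le> pi" for t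
  proof -
    have "\<bar>cos (M * t)\<bar> * \<bar>cos (t / 2)\<bar> \<le> 1 * 1"
      by (intro mult_mono) auto
    moreover have "sin (x / 2) ^ 2 \<le> sin (t / 2) ^ 2"
      using sinmono[OF t] sinpos[of x] x by (intro power_mono) auto
    moreover have "sin (x / 2) > 0" using sinpos[of x] x by simp
    ultimately show ?thesis using M
      unfolding E'_def abs_divide abs_mult abs_minus_cancel
      by (intro frac_le) (auto simp: abs_mult)
  qed
  have "sin (real (Suc n) * pi) = 0" for n by (rule sin_npi)
  moreover have "cos (M * pi) = 0"
  proof -
    have "M * pi = real N * pi + pi / 2" by (simp add: M_def algebra_simps)
    then show ?thesis by (simp add: cos_add)
  qed
  \<comment> \<open>The right end is the base point for the mean value theorem: the sines, (pi -
    t)/2 and cos(M t) all vanish at pi.\<close>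
  ultimately have "E pi = 0" by (simp add: E_def del: of_nat_Suc)
  have Ex: "\<bar>E x\<bar> \<le> pi * (1 / (4 * M * sin (x / 2) ^ 2))"
  proof (cases "x = pi")
    case False
    then have "x < pi" using x by simp
    then obtain z where z: "z > x" "z < pi" "E pi - E x = (pi - x) * E' z"
      using MVT2[of x pi E E'] deriv by auto
    then have "\<bar>E x\<bar> = (pi - x) * \<bar>E' z\<bar>"
      using \<open>E pi = 0\<close> x by (metis abs_minus_cancel abs_mult abs_of_nonneg diff_0 diff_ge_0_iff_ge)
    also have "\<dots> \<le> pi * (1 / (4 * M * sin (x / 2) ^ 2))"
      using bound[of z] z x by (intro mult_mono) auto
    finally show ?thesis .
  qed (use \<open>E pi = 0\<close> M in simp)
  have sx: "sin (x / 2) > 0" using sinpos[of x] x by simp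
  have cx: "\<bar>cos (M * x) / (2 * M * sin (x / 2))\<bar> \<le> 1 / (2 * M * sin (x / 2))"
    using M sx by (simp add: abs_mult divide_right_mono)
  have "\<bar>(\<Sum>n<N. sin (real (Suc n) * x) / real (Suc n)) - (pi - x) / 2\<bar>
      \<le> 1 / (2 * M * sin (x / 2)) + pi * (1 / (4 * M * sin (x / 2) ^ 2))"
    using Ex cx unfolding E_def by linarith
  also have "\<dots> = (1 / sin (x / 2) + pi / (2 * sin (x / 2) ^ 2)) * (1 / (2 * M))"
    using M sx by (simp add: field_simps power2_eq_square)
  \<comment> \<open>Here 1/(2M) = 1/(2N + 1), which is at most 1/(N + 1).\<close>
  also have "\<dots> \<le> (1 / sin (x / 2) + pi / (2 * sin (x / 2) ^ 2)) * inverse (real (Suc N))"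
    using sx by (intro mult_left_mono) (auto simp: M_def field_simps)
  finally show ?thesis .
qed

text \<open>Beyond pi, the reflection x -> 2 pi - x changes the sign of every sine and of (pi -
  x)/2, which leads back to the range of the error bound.\<close>

lemma sin_series_sums:
  fixes x :: real
  assumes x: "0 < x" "x < 2 * pi"
  shows "(\<lambda>n. sin (real (Suc n) * x) / real (Suc n)) sums ((pi - x) / 2)"
proof -
  have main: "(\<lambda>n. sin (real (Suc n) * y) / real (Suc n)) sums ((pi - y) / 2)"
    if y: "0 < y" "y \<le> pi" for y :: real
  proof -
    have "(\<lambda>N. (1 / sin (y / 2) + pi / (2 * sin (y / 2) ^ 2)) * inverse (real (Suc N))) \<longlonglongrightarrow> 0"
      by (intro tendsto_mult_right_zero LIMSEQ_inverse_real_of_nat)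
    then have "(\<lambda>N. (\<Sum>n<N. sin (real (Suc n) * y) / real (Suc n)) - (pi - y) / 2) \<longlonglongrightarrow> 0"
      by (rule tendsto_0_le[where K = 1])
        (use sin_series_partial_sum_bound[OF y] in \<open>auto simp del: of_nat_Suc intro!: always_eventually order.trans[OF _ abs_ge_self]\<close>)
    then show ?thesis unfolding sums_def by (simp add: LIM_zero_iff)
  qed
  show ?thesis
  proof (cases "x \<le> pi")
    case False
    have reflect: "sin (real k * (2 * pi - x)) = - sin (real k * x)" for k :: nat
    proof -
      have "sin (real k * (2 * pi - x)) = sin (2 * pi * real k - real k * x)"
        by (simp add: algebra_simps)
      then show ?thesis
        using sin_int_2pin[of "int k"] cos_int_2pin[of "int k"] by (simp add: sin_diff)
    qed
    have "(\<lambda>n. - (sin (real (Suc n) * x) / real (Suc n))) sums ((pi - (2 * pi - x)) / 2)"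
      using main[of "2 * pi - x"] False x by (simp add: reflect del: of_nat_Suc)
    from sums_minus[OF this] have "(\<lambda>n. sin (real (Suc n) * x) / real (Suc n)) sums
        - ((pi - (2 * pi - x)) / 2)" by (simp only: minus_minus)
    moreover have "- ((pi - (2 * pi - x)) / 2) = (pi - x) / 2" by (simp add: field_simps)
    ultimately show ?thesis by (simp only:)
  qed (use main x in auto)
qed

text \<open>Periodicity reduces to x = 2 pi frac y. At integers every term is 0, which is the value
  of \<open>sawtooth\<close> there.\<close>

lemma sawtooth_fourier_series:
  "(\<lambda>n. sin (2 * pi * real (Suc n) * y) / real (Suc n)) sums (- pi * sawtooth y)"
proof -
  have red: "sin (2 * pi * real k * y) = sin (real k * (2 * pi * frac y))" for k :: nat
  proof -
    have "2 * pi * real k * y = real k * (2 * pi * frac y) + 2 * pi * of_int (int k * \<lfloor>y\<rfloor>)"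
      by (simp add: frac_def algebra_simps)
    then show ?thesis
      by (simp add: sin_add sin_int_2pin cos_int_2pin del: of_int_mult)
  qed
  show ?thesis
  proof (cases "y \<in> \<int>")
    case True
    then show ?thesis by (simp add: red sawtooth_def frac_eq_0_iff[THEN iffD2] del: of_nat_Suc)
  next
    case False
    then have "frac y > 0" "frac y < 1" by (auto simp: frac_gt_0_iff frac_lt_1)
    then have "(\<lambda>n. sin (real (Suc n) * (2 * pi * frac y)) / real (Suc n)) sums
        ((pi - 2 * pi * frac y) / 2)"
      by (intro sin_series_sums) auto
    moreover have "(pi - 2 * pi * frac y) / 2 = - pi * sawtooth y"
      using False by (simp add: sawtooth_def field_simps)
    ultimately show ?thesis by (simp only: red)
  qed
qed

section \<open>Dedekind sums modulo a prime\<close>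

lemma sawtooth_add_of_int: "sawtooth (y + of_int k) = sawtooth y"
  by (simp add: sawtooth_def)

lemma sawtooth_minus: "sawtooth (- y) = - sawtooth y"
  by (auto simp: sawtooth_def frac_neg minus_in_Ints_iff)

section \<open>Roots of unity, residues modulo p and symmetries of the Dedekind sum\<close>

lemma cis_multiple_2pi_eq_1_iff:
  assumes "N > 0"
  shows "cis (2 * pi * of_int c / of_nat N) = 1 \<longleftrightarrow> int N dvd c"
proof
  assume "cis (2 * pi * of_int c / of_nat N) = 1"
  then have "cos (2 * pi * of_int c / of_nat N) = 1" by (metis cis.sel(1) one_complex.sel(1))
  then obtain k :: int where "2 * pi * of_int c / of_nat N = of_int k * (2 * pi)"
    by (auto simp: cos_one_2pi_int)
  then have "(of_int c :: real) = of_int (k * int N)" using assms by (simp add: field_simps)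
  then show "int N dvd c" by (simp only: of_int_eq_iff) simp
next
  assume "int N dvd c"
  then obtain k where "c = int N * k" by blast
  then have "2 * pi * of_int c / of_nat N = 2 * pi * of_int k" using assms by simp
  then show "cis (2 * pi * of_int c / of_nat N) = 1"
    by (simp add: complex_eq_iff sin_int_2pin cos_int_2pin)
qed

text \<open>A geometric sum. It serves twice: with N = p for the modulus of the Gauss sum and with N
  = m for the orthogonality of characters.\<close>

lemma sum_cis_multiple_2pi:
  assumes "N > 0"
  shows "(\<Sum>n<N. cis (2 * pi * of_int (c * int n) / of_nat N)) =
    (if int N dvd c then of_nat N else 0)"
proof -
  define z where "z = cis (2 * pi * of_int c / of_nat N)"
  have "cis (2 * pi * of_int (c * int n) / of_nat N) = z ^ n" for n
    by (simp add: z_def DeMoivre mult_ac)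
  moreover have "z ^ N = 1"
    using assms by (simp add: z_def DeMoivre complex_eq_iff sin_int_2pin cos_int_2pin)
  ultimately show ?thesis
    using cis_multiple_2pi_eq_1_iff[OF assms, of c] by (auto simp: sum_gp_strict simp flip: z_def)
qed

locale prime_modulus =
  fixes p :: nat
  assumes prime_p: "prime p"
begin

abbreviation U :: "int set" where "U \<equiv> {1..int p - 1}"

abbreviation e :: "int \<Rightarrow> complex" where "e k \<equiv> cis (2 * pi * of_int k / of_nat p)"

abbreviation saw :: "int \<Rightarrow> real" where "saw k \<equiv> sawtooth (of_int k / of_nat p)"

lemma p_gt_1: "p > 1" using prime_gt_1_nat[OF prime_p] .

lemma carrier_Fp_units: "carrier (Fp_units p) = U"
  by (auto simp: residue_ring_def)

lemma mult_Fp_units: "x \<otimes>\<^bsub>Fp_units p\<^esub> y = x * y mod int p"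
  by (simp add: residue_ring_def)

lemma one_Fp_units: "\<one>\<^bsub>Fp_units p\<^esub> = 1"
  by (simp add: residue_ring_def)

lemma not_dvd_U: "a \<in> U \<Longrightarrow> \<not> int p dvd a"
  by (auto dest: zdvd_imp_le)

lemma mod_in_U: "\<not> int p dvd a \<Longrightarrow> a mod int p \<in> U"
proof -
  assume "\<not> int p dvd a"
  then have "a mod int p \<noteq> 0" by (simp add: dvd_eq_mod_eq_0)
  moreover have "0 \<le> a mod int p" "a mod int p < int p" using p_gt_1 by simp_all
  ultimately show ?thesis unfolding atLeastAtMost_iff by linarith
qed

lemma mod_U: "a \<in> U \<Longrightarrow> a mod int p = a"
  by auto

lemma dvd_mult_iff: "int p dvd a * b \<longleftrightarrow> int p dvd a \<or> int p dvd b"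
  using prime_p by (simp add: prime_dvd_mult_iff)

lemma inverse_mod_exists:
  assumes "\<not> int p dvd a"
  obtains b where "b \<in> U" "[a * b = 1] (mod int p)"
proof -
  have "coprime a (int p)"
    using assms prime_p by (metis coprime_commute prime_imp_coprime prime_int_nat_transfer prime_nat_int_transfer)
  then obtain x where x: "[a * x = 1] (mod int p)" using cong_solve_coprime_int by blast
  then have "\<not> int p dvd x"
    using p_gt_1 by (metis cong_dvd_iff dvd_mult int_dvd_int_iff nat_dvd_1_iff_1 of_nat_1 less_irrefl)
  moreover have "[a * (x mod int p) = 1] (mod int p)"
    using x by (simp add: cong_def mod_mult_right_eq)
  ultimately show thesis using that mod_in_U by blast
qed

lemma bij_betw_mult_mod:
  assumes "\<not> int p dvd a"
  shows "bij_betw (\<lambda>c. a * c mod int p) U U"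
proof -
  have "inj_on (\<lambda>c. a * c mod int p) U"
  proof (rule inj_onI)
    fix x y assume xy: "x \<in> U" "y \<in> U" "a * x mod int p = a * y mod int p"
    then have "int p dvd a * (x - y)" by (simp add: mod_eq_dvd_iff algebra_simps)
    then have "int p dvd x - y" using assms by (simp add: dvd_mult_iff)
    then have "x mod int p = y mod int p" by (simp add: mod_eq_dvd_iff)
    then show "x = y" using xy by (simp only: mod_U)
  qed
  moreover have "(\<lambda>c. a * c mod int p) ` U \<subseteq> U"
    using assms by (auto simp only: image_subset_iff dvd_mult_iff intro!: mod_in_U dest!: not_dvd_U)
  ultimately show ?thesis by (simp add: bij_betw_def endo_inj_surj)
qed

text \<open>The substitution c -> a c in a complete sum over the units. Periodicity of
  \<open>f\<close> allows the product to stay unreduced.\<close>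

lemma sum_mult_invariant:
  assumes "\<not> int p dvd a" and "\<And>x. f (x mod int p) = f x"
  shows "(\<Sum>c\<in>U. f (a * c)) = sum f U"
proof -
  have "(\<Sum>c\<in>U. f (a * c)) = (\<Sum>c\<in>U. f (a * c mod int p))" by (simp only: assms(2))
  also have "\<dots> = sum f U" by (rule sum.reindex_bij_betw[OF bij_betw_mult_mod[OF assms(1)]])
  finally show ?thesis .
qed

lemma e_add: "e (a + b) = e a * e b"
  by (simp add: cis_mult add_divide_distrib distrib_left)

lemma e_mod: "e (a mod int p) = e a"
proof -
  have "e a = e (int p * (a div int p)) * e (a mod int p)" by (subst e_add[symmetric]) simp
  moreover have "e (int p * (a div int p)) = 1"
    using p_gt_1 by (subst cis_multiple_2pi_eq_1_iff) auto
  ultimately show ?thesis by simp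
qed

lemma saw_mod: "saw (a mod int p) = saw a"
proof -
  have "real_of_int a = real_of_int (a mod int p + int p * (a div int p))" by simp
  also have "\<dots> = real_of_int (a mod int p) + real p * real_of_int (a div int p)"
    by (simp only: of_int_add of_int_mult of_int_of_nat_eq)
  finally have "of_int a / real p = of_int (a mod int p) / real p + of_int (a div int p)"
    using p_gt_1 by (simp add: add_divide_distrib)
  then show ?thesis by (simp only: sawtooth_add_of_int)
qed

lemma saw_minus: "saw (- a) = - saw a"
  using sawtooth_minus[of "of_int a / of_nat p"] by simp

lemma dedekind_sum_eq: "dedekind_sum c p = (\<Sum>a\<in>U. saw a * saw (a * c))"
proof -
  have "U = int ` {1..p - 1}"
    using p_gt_1 by (simp add: image_int_atLeastAtMost of_nat_diff)
  then show ?thesis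
    by (simp add: dedekind_sum_def sum.reindex)
qed

lemma dedekind_sum_mod: "dedekind_sum (c mod int p) p = dedekind_sum c p"
proof -
  have "saw (a * (c mod int p)) = saw (a * c)" for a
    using saw_mod[of "a * (c mod int p)"] saw_mod[of "a * c"] by (simp add: mod_mult_right_eq)
  then show ?thesis by (simp only: dedekind_sum_eq)
qed

lemma dedekind_sum_minus: "dedekind_sum (- c) p = - dedekind_sum c p"
proof -
  have "saw (a * (- c)) = - saw (a * c)" for a using saw_minus[of "a * c"] by simp
  then show ?thesis by (simp only: dedekind_sum_eq) (simp add: sum_negf)
qed

text \<open>Replace the summation variable c by b c: since b c a = c modulo p, the two sawtooth
  factors trade places.\<close>

lemma dedekind_sum_inverse:
  assumes "[a * b = 1] (mod int p)"
  shows "dedekind_sum a p = dedekind_sum b p"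
proof -
  have nd: "\<not> int p dvd b"
    using assms p_gt_1 by (metis cong_dvd_iff dvd_mult int_dvd_int_iff nat_dvd_1_iff_1 of_nat_1 less_irrefl)
  have per: "saw (x mod int p) * saw ((x mod int p) * a) = saw x * saw (x * a)" for x
    using saw_mod[of "(x mod int p) * a"] saw_mod[of "x * a"] saw_mod[of x] by (simp add: mod_mult_left_eq)
  have "dedekind_sum a p = (\<Sum>c\<in>U. saw (b * c) * saw (b * c * a))"
    unfolding dedekind_sum_eq
    by (rule sum_mult_invariant[where f = "\<lambda>x. saw x * saw (x * a)", OF nd per, symmetric])
  also have "\<dots> = (\<Sum>c\<in>U. saw c * saw (c * b))"
  proof (rule sum.cong)
    fix c
    have "[c * (a * b) = c * 1] (mod int p)" by (rule cong_mult[OF cong_refl assms])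
    then have "[b * c * a = c] (mod int p)" by (simp add: mult_ac)
    then have "saw (b * c * a) = saw c" by (metis cong_def saw_mod)
    then show "saw (b * c) * saw (b * c * a) = saw c * saw (c * b)" by (simp add: mult_ac)
  qed simp
  also have "\<dots> = dedekind_sum b p" by (simp only: dedekind_sum_eq)
  finally show ?thesis .
qed

end

section \<open>Gauss sums and odd characters\<close>

locale mod_character = prime_modulus +
  fixes \<chi> :: "int \<Rightarrow> complex"
  assumes char: "\<chi> \<in> mult_characters p"
begin

abbreviation X :: "int \<Rightarrow> complex" where "X \<equiv> char_int p \<chi>"

lemma X_mod: "X (n mod int p) = X n"
  by (simp add: char_int_def dvd_mod_iff)

lemma X_dvd: "int p dvd n \<Longrightarrow> X n = 0"
  by (simp add: char_int_def)

lemma X_mult: "X (a * b) = X a * X b"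
proof (cases "int p dvd a \<or> int p dvd b")
  case False
  then have "a mod int p \<in> carrier (Fp_units p)" "b mod int p \<in> carrier (Fp_units p)"
    by (auto simp only: carrier_Fp_units intro!: mod_in_U)
  moreover have "\<chi> \<in> hom (Fp_units p) Complex_units"
    using char by (simp only: mult_characters_def Int_iff)
  ultimately have "\<chi> ((a mod int p) \<otimes>\<^bsub>Fp_units p\<^esub> (b mod int p)) =
      \<chi> (a mod int p) \<otimes>\<^bsub>Complex_units\<^esub> \<chi> (b mod int p)"
    unfolding hom_def by blast
  then have "\<chi> (a * b mod int p) = \<chi> (a mod int p) * \<chi> (b mod int p)"
    by (simp only: mult_Fp_units mod_mult_eq Complex_units_def monoid.simps)
  with False show ?thesis by (simp add: char_int_def dvd_mult_iff)
qed (auto simp: char_int_def)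

lemma X_nonzero: "\<not> int p dvd a \<Longrightarrow> X a \<noteq> 0"
proof -
  assume a: "\<not> int p dvd a"
  have "\<chi> \<in> hom (Fp_units p) Complex_units"
    using char by (simp only: mult_characters_def Int_iff)
  then have "\<chi> (a mod int p) \<in> carrier Complex_units"
    by (rule hom_in_carrier) (simp only: carrier_Fp_units mod_in_U[OF a])
  with a show ?thesis by (simp add: char_int_def Complex_units_def)
qed

lemma X_1: "X 1 = 1"
  using X_mult[of 1 1] X_nonzero[of 1] p_gt_1 by auto

lemma X_power: "X (a ^ n) = X a ^ n"
  by (induction n) (auto simp: X_1 X_mult)

lemma X_prod: "finite A \<Longrightarrow> X (\<Prod>i\<in>A. f i) = (\<Prod>i\<in>A. X (f i))"
  by (induction A rule: finite_induct) (auto simp: X_1 X_mult)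

lemma X_cong: "[a = b] (mod int p) \<Longrightarrow> X a = X b"
  by (metis X_mod cong_def)

text \<open>By Fermat's little theorem \<open>X a\<close> is a (p - 1)-th root of unity.\<close>

lemma norm_X:
  assumes "\<not> int p dvd a"
  shows "norm (X a) = 1"
proof -
  have "[a ^ (p - 1) = 1] (mod int p)"
  proof -
    define b where "b = nat (a mod int p)"
    have b: "int b = a mod int p" using p_gt_1 by (simp add: b_def)
    have "\<not> p dvd b"
      using assms b by (metis dvd_mod_iff dvd_refl int_dvd_int_iff)
    then have "[b ^ (p - 1) = 1] (mod p)" by (rule fermat_theorem[OF prime_p])
    then have "[int b ^ (p - 1) = 1] (mod int p)" by (metis cong_int_iff of_nat_1 of_nat_power)
    then show ?thesis by (simp add: b cong_def power_mod)
  qed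
  then have "X a ^ (p - 1) = 1" using X_cong X_power X_1 by metis
  then have "norm (X a) ^ (p - 1) = 1" by (metis norm_one norm_power)
  then show ?thesis using p_gt_1 power_eq_imp_eq_base[of "norm (X a)" "p - 1" 1] by simp
qed

lemma X_mult_cnj: "X a * cnj (X a) = (if int p dvd a then 0 else 1)"
  by (auto simp: complex_norm_square[symmetric] norm_X X_dvd)

lemma X_minus_1: "X (-1) = 1 \<or> X (-1) = -1"
  using X_mult[of "-1" "-1"] by (simp add: X_1 square_eq_1_iff)

definition gauss_sum :: "int \<Rightarrow> complex" where "gauss_sum n = (\<Sum>a\<in>U. X a * e (a * n))"

text \<open>This is B(chi). For nonprincipal chi the constant -1/2 of the sawtooth sums to 0, so it
  is the generalized Bernoulli number B_(1,chi).\<close>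

definition saw_sum :: complex where "saw_sum = (\<Sum>a\<in>U. X a * of_real (saw a))"

text \<open>Substitute n a for a; \<open>X n\<close> has modulus 1, so its conjugate is its
  inverse.\<close>

lemma gauss_sum_coprime:
  assumes "\<not> int p dvd n"
  shows "gauss_sum n = cnj (X n) * gauss_sum 1"
proof -
  have "X n * gauss_sum n = (\<Sum>a\<in>U. X (n * a) * e (n * a))"
    by (simp add: gauss_sum_def sum_distrib_left X_mult mult_ac)
  also have "\<dots> = (\<Sum>a\<in>U. X a * e a)"
    by (rule sum_mult_invariant[where f = "\<lambda>x. X x * e x"]) (simp_all only: assms X_mod e_mod not_False_eq_True)
  also have "\<dots> = gauss_sum 1" by (simp add: gauss_sum_def)
  finally have "cnj (X n) * gauss_sum 1 = (X n * cnj (X n)) * gauss_sum n" by simp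
  then show ?thesis using assms by (simp add: X_mult_cnj)
qed

lemma dedekind_character_sum:
  "(\<Sum>c\<in>U. X c * of_real (dedekind_sum c p)) = of_real ((norm saw_sum)\<^sup>2)"
proof -
  have "(\<Sum>c\<in>U. X c * of_real (dedekind_sum c p)) =
      (\<Sum>c\<in>U. \<Sum>a\<in>U. X c * of_real (saw a) * of_real (saw (a * c)))"
    by (simp add: dedekind_sum_eq sum_distrib_left mult_ac)
  also have "\<dots> = (\<Sum>a\<in>U. \<Sum>c\<in>U. X c * of_real (saw a) * of_real (saw (a * c)))"
    by (rule sum.swap)
  also have "\<dots> = (\<Sum>a\<in>U. cnj (X a) * of_real (saw a) * saw_sum)"
  proof (rule sum.cong)
    fix a assume "a \<in> U"
    then have a: "\<not> int p dvd a" by (rule not_dvd_U)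
    have "(\<Sum>c\<in>U. X c * of_real (saw a) * of_real (saw (a * c))) =
        (\<Sum>c\<in>U. cnj (X a) * of_real (saw a) * (X (a * c) * of_real (saw (a * c))))"
    proof (rule sum.cong)
      fix c
      \<comment> \<open>This separates the variables: after c -> a c the inner sum no longer depends
        on a.\<close>
      have "X c = cnj (X a) * X (a * c)"
        using X_mult_cnj[of a] a by (simp add: X_mult mult_ac)
      then show "X c * of_real (saw a) * of_real (saw (a * c)) =
          cnj (X a) * of_real (saw a) * (X (a * c) * of_real (saw (a * c)))" by (simp only: mult_ac)
    qed simp
    also have "\<dots> = cnj (X a) * of_real (saw a) * (\<Sum>c\<in>U. X (a * c) * of_real (saw (a * c)))"
      by (simp only: sum_distrib_left)
    also have "(\<Sum>c\<in>U. X (a * c) * of_real (saw (a * c))) = saw_sum" unfolding saw_sum_def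
      by (rule sum_mult_invariant[where f = "\<lambda>x. X x * of_real (saw x)"])
        (simp_all only: a X_mod saw_mod not_False_eq_True)
    finally show "(\<Sum>c\<in>U. X c * of_real (saw a) * of_real (saw (a * c))) =
        cnj (X a) * of_real (saw a) * saw_sum" .
  qed simp
  also have "\<dots> = cnj saw_sum * saw_sum"
    by (simp add: saw_sum_def sum_distrib_right cnj_sum)
  finally show ?thesis by (metis complex_norm_square mult.commute of_real_power)
qed

lemma even_dedekind_character_sum:
  assumes "X (-1) = 1"
  shows "(\<Sum>c\<in>U. X c * of_real (dedekind_sum c p)) = 0"
proof -
  have nd: "\<not> int p dvd (-1)" using p_gt_1 by simp
  have "(\<Sum>c\<in>U. X c * of_real (dedekind_sum c p)) =
      (\<Sum>c\<in>U. X (-1 * c) * of_real (dedekind_sum (-1 * c) p))"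
    by (rule sum_mult_invariant[symmetric, where f = "\<lambda>x. X x * of_real (dedekind_sum x p)"])
      (simp_all only: nd X_mod dedekind_sum_mod not_False_eq_True)
  also have "\<dots> = - (\<Sum>c\<in>U. X c * of_real (dedekind_sum c p))"
  proof -
    have "X (-1 * c) * of_real (dedekind_sum (-1 * c) p) = - (X c * of_real (dedekind_sum c p))" for c
      using X_mult[of "-1" c] dedekind_sum_minus[of c] assms by simp
    then show ?thesis by (simp only: sum_negf)
  qed
  finally show ?thesis by simp
qed

end

section \<open>Odd characters: the Gauss sum and the value L(1,chi)\<close>

locale odd_mod_character = mod_character +
  assumes odd: "X (-1) = -1"
begin

lemma X_minus: "X (- a) = - X a"
  using X_mult[of "-1" a] by (simp add: odd)

text \<open>The Fourier series runs over all n, so multiples of p occur as well. There the left side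
  is the sum of \<open>X\<close> over \<open>U\<close>, which a -> -a negates, hence 0.\<close>

lemma gauss_sum_eq: "gauss_sum n = cnj (X n) * gauss_sum 1"
proof (cases "int p dvd n")
  case True
  have nd: "\<not> int p dvd (-1)" using p_gt_1 by simp
  have "sum X U = (\<Sum>a\<in>U. X (-1 * a))"
    by (rule sum_mult_invariant[where f = X, OF nd X_mod, symmetric])
  also have "\<dots> = - sum X U" by (simp add: X_minus sum_negf)
  finally have "sum X U = 0" by simp
  moreover have "e (a * n) = 1" for a
    using p_gt_1 True by (subst cis_multiple_2pi_eq_1_iff) auto
  ultimately show ?thesis using True by (simp only: gauss_sum_def X_dvd) simp
qed (rule gauss_sum_coprime)

text \<open>Parseval's identity for the finite Fourier transform of \<open>X\<close>.\<close>

lemma norm_gauss_sum: "(norm (gauss_sum 1))\<^sup>2 = real p"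
proof -
  have p0: "p > 0" using p_gt_1 by simp
  have "(\<Sum>n<p. gauss_sum (int n) * cnj (gauss_sum (int n))) =
      (\<Sum>n<p. \<Sum>a\<in>U. \<Sum>b\<in>U. X a * cnj (X b) * e ((a - b) * int n))"
  proof (rule sum.cong)
    fix n
    have "e (a * int n) * cnj (e (b * int n)) = e ((a - b) * int n)" for a b
      by (simp add: cis_cnj cis_mult diff_divide_distrib[symmetric] left_diff_distrib right_diff_distrib)
    then show "gauss_sum (int n) * cnj (gauss_sum (int n)) =
        (\<Sum>a\<in>U. \<Sum>b\<in>U. X a * cnj (X b) * e ((a - b) * int n))"
      unfolding gauss_sum_def cnj_sum sum_product complex_cnj_mult
      by (intro sum.cong refl) (metis (no_types, lifting) mult.assoc mult.left_commute)
  qed simp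
  also have "\<dots> = (\<Sum>a\<in>U. \<Sum>n<p. \<Sum>b\<in>U. X a * cnj (X b) * e ((a - b) * int n))"
    by (rule sum.swap)
  also have "\<dots> = (\<Sum>a\<in>U. \<Sum>b\<in>U. \<Sum>n<p. X a * cnj (X b) * e ((a - b) * int n))"
    by (intro sum.cong refl sum.swap)
  \<comment> \<open>Summation over n removes all terms with a \<noteq> b; each diagonal term gives p
    because \<open>X a\<close> has modulus 1.\<close>
  also have "\<dots> = (\<Sum>a\<in>U. \<Sum>b\<in>U. if b = a then of_nat p else 0)"
  proof (intro sum.cong refl)
    fix a b assume ab: "a \<in> U" "b \<in> U"
    have "int p dvd a - b \<longleftrightarrow> b = a"
      using ab by (metis mod_U mod_eq_dvd_iff)
    then have "(\<Sum>n<p. e ((a - b) * int n)) = (if b = a then of_nat p else 0)"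
      by (simp only: sum_cis_multiple_2pi[OF p0])
    then show "(\<Sum>n<p. X a * cnj (X b) * e ((a - b) * int n)) = (if b = a then of_nat p else 0)"
      using X_mult_cnj[of a] not_dvd_U[OF ab(1)]
      by (simp only: sum_distrib_left[symmetric]) auto
  qed
  also have "\<dots> = of_nat (p - 1) * of_nat p"
    by (simp add: nat_diff_distrib')
  finally have 1: "(\<Sum>n<p. gauss_sum (int n) * cnj (gauss_sum (int n))) = of_nat (p - 1) * of_nat p" .
  \<comment> \<open>Second evaluation of the same sum: the term n = 0 vanishes, and each of the
    other p - 1 equals the squared modulus of \<open>gauss_sum 1\<close>.\<close>
  have "(\<Sum>n<p. gauss_sum (int n) * cnj (gauss_sum (int n))) =
      (\<Sum>n<p. (if n = 0 then 0 else 1) * (gauss_sum 1 * cnj (gauss_sum 1)))"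
  proof (rule sum.cong)
    fix n assume "n \<in> {..<p}"
    then have "int p dvd int n \<longleftrightarrow> n = 0" by (auto dest: dvd_imp_le)
    then have "X (int n) * cnj (X (int n)) = (if n = 0 then 0 else 1)" by (simp only: X_mult_cnj)
    then show "gauss_sum (int n) * cnj (gauss_sum (int n)) =
        (if n = 0 then 0 else 1) * (gauss_sum 1 * cnj (gauss_sum 1))"
      by (subst (1 2) gauss_sum_eq) (simp add: mult_ac)
  qed simp
  also have "\<dots> = (\<Sum>n<p. if n = 0 then 0 else 1) * (gauss_sum 1 * cnj (gauss_sum 1))"
    by (simp only: sum_distrib_right)
  also have "(\<Sum>n<p. if n = 0 then 0 else (1::complex)) = of_nat (p - 1)"
  proof -
    have "(\<Sum>n<p. if n = 0 then 0 else (1::complex)) = (\<Sum>n\<in>{1..<p}. 1)"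
      by (rule sum.mono_neutral_cong_right) auto
    then show ?thesis by simp
  qed
  finally have "of_nat (p - 1) * (gauss_sum 1 * cnj (gauss_sum 1)) = of_nat (p - 1) * of_nat p"
    using 1 by (simp only:)
  moreover have "(of_nat (p - 1) :: complex) \<noteq> 0" using p_gt_1 by simp
  ultimately have "gauss_sum 1 * cnj (gauss_sum 1) = of_nat p" by (metis mult_left_cancel)
  then have "complex_of_real ((norm (gauss_sum 1))\<^sup>2) = of_real (real p)"
    by (simp only: complex_norm_square of_real_of_nat_eq)
  then show ?thesis by (simp only: of_real_eq_iff)
qed

text \<open>The sine splits into e(an) and e(-an). For odd chi the Gauss sums at n and -n are
  opposite, so the two parts reinforce each other.\<close>

lemma sin_character_sum:
  "(\<Sum>a\<in>U. X a * of_real (sin (2 * pi * of_int (a * n) / of_nat p))) = - \<i> * cnj (X n) * gauss_sum 1"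
proof -
  have "2 * \<i> * of_real (sin (2 * pi * of_int (a * n) / of_nat p)) = e (a * n) - e (a * (- n))" for a
    by (simp add: complex_eq_iff)
  then have "2 * \<i> * (\<Sum>a\<in>U. X a * of_real (sin (2 * pi * of_int (a * n) / of_nat p))) =
      (\<Sum>a\<in>U. X a * (e (a * n) - e (a * (- n))))"
    unfolding sum_distrib_left by (intro sum.cong refl) (simp only: mult.left_commute)
  also have "\<dots> = gauss_sum n - gauss_sum (- n)"
    by (simp only: gauss_sum_def right_diff_distrib sum_subtractf)
  also have "\<dots> = 2 * cnj (X n) * gauss_sum 1"
    using gauss_sum_eq[of n] gauss_sum_eq[of "- n"] by (simp add: X_minus)
  finally have "\<i> * (\<Sum>a\<in>U. X a * of_real (sin (2 * pi * of_int (a * n) / of_nat p))) =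
      cnj (X n) * gauss_sum 1" by simp
  then have "- \<i> * (\<i> * (\<Sum>a\<in>U. X a * of_real (sin (2 * pi * of_int (a * n) / of_nat p)))) =
      - \<i> * (cnj (X n) * gauss_sum 1)" by (simp only:)
  moreover have "- \<i> * (\<i> * z) = z" for z by (simp flip: mult.assoc)
  ultimately show ?thesis by (simp only: mult.assoc)
qed

text \<open>A finite combination of convergent Fourier series converges, so convergence of the
  L-series comes with its value. The Gauss sums produce the conjugate values of \<open>X\<close>,
  hence the outer conjugation.\<close>

lemma L_one_series_sums:
  "(\<lambda>n. X (int (Suc n)) / of_nat (Suc n)) sums (cnj (- pi * saw_sum / (- \<i> * gauss_sum 1)))"
proof -
  have "(\<lambda>n. \<Sum>a\<in>U. X a * of_real (sin (2 * pi * of_int (a * int (Suc n)) / of_nat p) / real (Suc n)))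
      sums (\<Sum>a\<in>U. X a * of_real (- pi * saw a))"
  proof (intro sums_sum sums_mult sums_of_real)
    fix a
    show "(\<lambda>n. sin (2 * pi * of_int (a * int (Suc n)) / of_nat p) / real (Suc n)) sums (- pi * saw a)"
      using sawtooth_fourier_series[of "of_int a / of_nat p"] by (simp add: mult_ac del: of_nat_Suc)
  qed
  moreover have "(\<Sum>a\<in>U. X a * of_real (- pi * saw a)) = - pi * saw_sum"
    by (simp add: saw_sum_def sum_distrib_left sum_negf mult_ac)
  moreover have "(\<Sum>a\<in>U. X a * of_real (sin (2 * pi * of_int (a * int (Suc n)) / of_nat p) / real (Suc n)))
      = - \<i> * gauss_sum 1 * (cnj (X (int (Suc n))) / of_nat (Suc n))" for n
    using sin_character_sum[of "int (Suc n)"]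
    by (simp del: of_nat_Suc add: sum_divide_distrib[symmetric] field_simps)
  ultimately have "(\<lambda>n. - \<i> * gauss_sum 1 * (cnj (X (int (Suc n))) / of_nat (Suc n))) sums (- pi * saw_sum)"
    by (simp only:)
  then have "(\<lambda>n. (- \<i> * gauss_sum 1 * (cnj (X (int (Suc n))) / of_nat (Suc n))) / (- \<i> * gauss_sum 1))
      sums (- pi * saw_sum / (- \<i> * gauss_sum 1))"
    by (rule sums_divide)
  moreover have "gauss_sum 1 \<noteq> 0" using norm_gauss_sum p_gt_1 by auto
  ultimately have "(\<lambda>n. cnj (X (int (Suc n))) / of_nat (Suc n)) sums (- pi * saw_sum / (- \<i> * gauss_sum 1))"
    by (simp del: of_nat_Suc)
  then show ?thesis by (subst sums_cnj[symmetric]) (simp del: of_nat_Suc)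
qed

lemma norm_L_one_square: "(norm (L_one p \<chi>))\<^sup>2 = pi\<^sup>2 / real p * (norm saw_sum)\<^sup>2"
proof -
  have "L_one p \<chi> = cnj (- pi * saw_sum / (- \<i> * gauss_sum 1))"
    unfolding L_one_def by (rule sums_unique[OF L_one_series_sums, symmetric])
  then show ?thesis
    by (simp add: norm_mult norm_divide power_divide power_mult_distrib norm_gauss_sum)
qed

end

section \<open>Characters trivial on the subgroup of given index\<close>

locale prime_index = prime_modulus +
  fixes m :: nat
  assumes m_dvd: "m dvd p - 1"
begin

abbreviation H :: "int set" where "H \<equiv> index_subgroup p m"

definition d :: nat where "d = (p - 1) div m"

lemma m_times_d: "m * d = p - 1"
  using m_dvd by (simp add: d_def)

lemma m_pos: "m > 0" and d_pos: "d > 0"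
proof -
  have "m * d > 0" using m_times_d p_gt_1 by simp
  then show "m > 0" "d > 0" by auto
qed

section \<open>A primitive root and the explicit form of the subgroup\<close>

definition g :: nat where "g = (SOME g. residue_primroot p g)"

lemma primroot_g: "residue_primroot p g"
proof -
  have "\<exists>g. residue_primroot p g"
  \<comment> \<open>The existence theorem used below concerns odd primes; modulo 2 the residue 1 is
    a primitive root.\<close>
  proof (cases "p = 2")
    case True
    then show ?thesis by (auto simp: residue_primroot_1_iff intro: exI[of _ "Suc 0"])
  next
    case False
    then have "odd p" using prime_p primes_dvd_imp_eq two_is_prime_nat by blast
    then obtain g where "\<forall>k>0. residue_primroot (p ^ k) g"
      using residue_primroot_odd_prime_power_exists[OF prime_p] by blast
    from this[rule_format, of 1] show ?thesis by auto
  qed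
  then show ?thesis unfolding g_def by (rule someI_ex)
qed

lemma power_g_cong_iff: "[int g ^ i = int g ^ j] (mod int p) \<longleftrightarrow> [i = j] (mod (p - 1))"
proof -
  have "[int g ^ i = int g ^ j] (mod int p) \<longleftrightarrow> [g ^ i = g ^ j] (mod p)"
    by (metis cong_int_iff of_nat_power)
  also have "\<dots> \<longleftrightarrow> [i = j] (mod (ord p g))"
    using primroot_g by (intro order_divides_expdiff) (simp add: residue_primroot_def)
  also have "ord p g = p - 1"
    using primroot_g totient_prime[OF prime_p] by (simp add: residue_primroot_def)
  finally show ?thesis .
qed

lemma not_dvd_power_g: "\<not> int p dvd int g ^ i"
proof -
  have "coprime p (g ^ i)" using primroot_g by (simp add: residue_primroot_def)
  then have "\<not> p dvd g ^ i" using p_gt_1 by (metis coprime_common_divisor_nat dvd_refl nat_neq_iff)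
  then show ?thesis by (metis int_dvd_int_iff of_nat_power)
qed

lemma power_g_exists:
  assumes "\<not> int p dvd u"
  obtains i where "[u = int g ^ i] (mod int p)"
proof -
  have "u mod int p \<in> U" by (rule mod_in_U[OF assms])
  then have "nat (u mod int p) \<in> totatives p"
    using p_gt_1 by (auto simp: totatives_prime[OF prime_p] zless_nat_eq_int_zless nat_less_iff)
  then obtain i where "nat (u mod int p) = g ^ i mod p"
    using residue_primroot_is_generator[OF p_gt_1 primroot_g] by (auto simp: bij_betw_def)
  then have "u mod int p = int (g ^ i mod p)" using p_gt_1 by (metis int_nat_eq pos_mod_sign of_nat_0_less_iff less_trans zero_less_one)
  then have "[u = int g ^ i] (mod int p)" by (simp add: cong_def zmod_int)
  then show thesis by (rule that)
qed

lemma group_Fp_units: "group (Fp_units p)"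
proof -
  interpret R: residues_prime p "residue_ring (int p)"
    by unfold_locales (use prime_p in auto)
  show ?thesis by (rule R.field_mult_group)
qed

lemma subgroup_H: "subgroup H (Fp_units p)" and card_rcosets_H: "card (rcosets\<^bsub>Fp_units p\<^esub> H) = m"
  using theI'[OF ex1_index_subgroup[OF prime_p m_dvd]] unfolding index_subgroup_def by auto

lemma H_subset_U: "H \<subseteq> U"
  using subgroup.subset[OF subgroup_H] by (simp only: carrier_Fp_units)

lemma card_H: "card H = d"
proof -
  interpret G: group "Fp_units p" by (rule group_Fp_units)
  have "finite (carrier (Fp_units p))" by (simp only: carrier_Fp_units) simp
  then have "card (rcosets\<^bsub>Fp_units p\<^esub> H) * card H = order (Fp_units p)"
    by (rule G.lagrange_finite[OF _ subgroup_H])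
  moreover have "order (Fp_units p) = p - 1"
    unfolding order_def by (simp only: carrier_Fp_units) simp
  ultimately have "m * card H = m * d" by (simp only: card_rcosets_H m_times_d)
  then show ?thesis using m_pos by simp
qed

lemma power_Fp_units: "x \<in> U \<Longrightarrow> x [^]\<^bsub>Fp_units p\<^esub> n = x ^ n mod int p"
proof (induction n)
  case 0
  then show ?case using p_gt_1 by (simp only: nat_pow_0 one_Fp_units) simp
next
  case (Suc n)
  then show ?case by (simp only: nat_pow_Suc mult_Fp_units) (simp add: mod_mult_right_eq mult.commute)
qed

lemma power_d_H:
  assumes "x \<in> H"
  shows "[x ^ d = 1] (mod int p)"
proof -
  interpret S: group "Fp_units p\<lparr>carrier := H\<rparr>"
    by (rule group.subgroup_imp_group[OF group_Fp_units subgroup_H])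
  have "x [^]\<^bsub>Fp_units p\<lparr>carrier := H\<rparr>\<^esub> order (Fp_units p\<lparr>carrier := H\<rparr>) = \<one>\<^bsub>Fp_units p\<lparr>carrier := H\<rparr>\<^esub>"
    by (rule S.pow_order_eq_1) (use assms in simp)
  then have "x [^]\<^bsub>Fp_units p\<^esub> d = \<one>\<^bsub>Fp_units p\<^esub>"
    using card_H by (simp add: order_def nat_pow_def)
  then have "x ^ d mod int p = 1"
    using power_Fp_units[OF subsetD[OF H_subset_U assms], of d] by (simp only: one_Fp_units)
  then show ?thesis using p_gt_1 by (simp add: cong_def)
qed

lemma power_g_power_d_iff: "[(int g ^ i) ^ d = 1] (mod int p) \<longleftrightarrow> m dvd i"
proof -
  have "[(int g ^ i) ^ d = 1] (mod int p) \<longleftrightarrow> [int g ^ (i * d) = int g ^ 0] (mod int p)"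
    by (simp add: power_mult)
  also have "\<dots> \<longleftrightarrow> m * d dvd i * d"
    unfolding power_g_cong_iff m_times_d by (simp add: cong_0_iff)
  finally show ?thesis using d_pos by simp
qed

text \<open>\<open>index_subgroup\<close> is a definite description, so its members are found by
  counting. Elements of \<open>H\<close> satisfy x^d = 1 by Lagrange, and logarithms place all
  solutions among the residues g^(m j) with j < d. As \<open>H\<close> has d elements, it exhausts
  them.\<close>

lemma mem_H_iff: "x \<in> H \<longleftrightarrow> x \<in> U \<and> [x ^ d = 1] (mod int p)"
proof
  define P where "P j = int g ^ (m * j) mod int p" for j
  have *: "x \<in> P ` {..<d}" if x: "x \<in> U" "[x ^ d = 1] (mod int p)" for x
  proof -
    obtain i where i: "[x = int g ^ i] (mod int p)"
      using power_g_exists[OF not_dvd_U[OF x(1)]] .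
    have "[(int g ^ i) ^ d = 1] (mod int p)"
      by (rule cong_trans[OF cong_sym[OF cong_pow[OF i]] x(2)])
    then obtain j where j: "i = m * j" by (auto simp: power_g_power_d_iff)
    \<comment> \<open>Only j modulo d matters, because exponents of \<open>g\<close> have period p -
      1 = m d.\<close>
    have "[m * j = m * (j mod d)] (mod (p - 1))"
      by (simp only: cong_def m_times_d[symmetric] mult_mod_right mod_mod_trivial)
    then have "[int g ^ i = int g ^ (m * (j mod d))] (mod int p)"
      by (simp add: power_g_cong_iff j)
    then have "x = P (j mod d)"
      using cong_trans[OF i] mod_U[OF x(1)] by (simp only: P_def cong_def)
    then show ?thesis using d_pos by simp
  qed
  have HP: "H \<subseteq> P ` {..<d}" using * power_d_H H_subset_U by blast
  have "H = P ` {..<d}"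
    by (rule card_seteq[OF _ HP]) (use card_H card_image_le[of "{..<d}" P] in auto)
  then show "x \<in> U \<and> [x ^ d = 1] (mod int p) \<Longrightarrow> x \<in> H" using * by blast
qed (use power_d_H H_subset_U in blast)

lemma mod_mem_H_iff: "u mod int p \<in> H \<longleftrightarrow> \<not> int p dvd u \<and> [u ^ d = 1] (mod int p)"
proof -
  have "u mod int p \<in> U \<longleftrightarrow> \<not> int p dvd u"
    using mod_in_U by auto
  then show ?thesis by (simp only: mem_H_iff) (simp add: cong_def power_mod)
qed

lemma power_g_mem_H_iff: "int g ^ i mod int p \<in> H \<longleftrightarrow> m dvd i"
  by (simp only: mod_mem_H_iff power_g_power_d_iff not_dvd_power_g not_False_eq_True simp_thms)

section \<open>Classification and orthogonality of the characters\<close>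

definition dlog :: "int \<Rightarrow> nat" where "dlog u = (SOME i. [u = int g ^ i] (mod int p))"

lemma dlog_cong: "\<not> int p dvd u \<Longrightarrow> [u = int g ^ dlog u] (mod int p)"
  unfolding dlog_def by (rule someI_ex) (blast elim: power_g_exists)

text \<open>\<open>dlog\<close> is an arbitrary choice within a class modulo p - 1. As m divides p -
  1, z^(p-1) = 1, so u -> z^(dlog u) is independent of this choice.\<close>

lemma power_dlog_eq:
  fixes z :: complex
  assumes "z ^ m = 1" and u: "[u = int g ^ i] (mod int p)"
  shows "z ^ dlog u = z ^ i"
proof -
  have z: "z ^ (p - 1) = 1" by (simp only: m_times_d[symmetric] power_mult assms(1) power_one)
  have "[u = int g ^ dlog u] (mod int p)"
    unfolding dlog_def using u by (rule someI)
  then have "[int g ^ dlog u = int g ^ i] (mod int p)"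
    using cong_trans[OF cong_sym u] by blast
  then have "[dlog u = i] (mod (p - 1))" by (simp only: power_g_cong_iff)
  moreover have "z ^ j = z ^ (j mod (p - 1))" for j
  proof -
    have "z ^ j = z ^ ((p - 1) * (j div (p - 1)) + j mod (p - 1))" by simp
    then show ?thesis by (simp only: power_add power_mult z power_one mult_1)
  qed
  ultimately show ?thesis by (metis cong_def)
qed

lemma mod_index_character:
  assumes "\<chi> \<in> characters_mod_index p m"
  shows "mod_character p \<chi>"
  using assms by unfold_locales (auto simp: characters_mod_index_def)

text \<open>A character is determined by its value at the generator \<open>g\<close>, and triviality
  at g^m makes that value an m-th root of unity. Conversely, any such z yields the character u ->
  z^(dlog u).\<close>

lemma bij_betw_characters:
  "bij_betw (\<lambda>\<chi>. char_int p \<chi> (int g)) (characters_mod_index p m) {z. z ^ m = 1}"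
  unfolding bij_betw_def
proof (intro conjI equalityI subsetI)
  show "inj_on (\<lambda>\<chi>. char_int p \<chi> (int g)) (characters_mod_index p m)"
  proof (rule inj_onI)
    fix \<chi> \<psi> assume \<chi>: "\<chi> \<in> characters_mod_index p m" and \<psi>: "\<psi> \<in> characters_mod_index p m"
      and eq: "char_int p \<chi> (int g) = char_int p \<psi> (int g)"
    interpret \<chi>: mod_character p \<chi> by (rule mod_index_character[OF \<chi>])
    interpret \<psi>: mod_character p \<psi> by (rule mod_index_character[OF \<psi>])
    have "\<chi> u = \<psi> u" if u: "u \<in> U" for u
    proof -
      have nd: "\<not> int p dvd u" by (rule not_dvd_U[OF u])
      obtain i where "[u = int g ^ i] (mod int p)" using power_g_exists[OF nd] .
      then have "char_int p \<chi> u = char_int p \<psi> u"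
        by (metis \<chi>.X_cong \<psi>.X_cong \<chi>.X_power \<psi>.X_power eq)
      then show ?thesis using nd mod_U[OF u] by (simp add: char_int_def)
    qed
    \<comment> \<open>Extensionality turns agreement on \<open>U\<close> into equality of
      functions.\<close>
    moreover have "\<chi> \<in> extensional U" "\<psi> \<in> extensional U"
      using \<chi>.char \<psi>.char by (simp_all only: mult_characters_def carrier_Fp_units Int_iff)
    ultimately show "\<chi> = \<psi>" by (intro extensionalityI)
  qed
next
  fix z assume "z \<in> (\<lambda>\<chi>. char_int p \<chi> (int g)) ` characters_mod_index p m"
  then obtain \<chi> where \<chi>: "\<chi> \<in> characters_mod_index p m" and z: "z = char_int p \<chi> (int g)" by blast
  interpret mod_character p \<chi> by (rule mod_index_character[OF \<chi>])
  have "int g ^ m mod int p \<in> H" by (simp only: power_g_mem_H_iff dvd_refl)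
  then have "char_int p \<chi> (int g ^ m) = 1"
    using \<chi> not_dvd_power_g by (simp add: characters_mod_index_def char_int_def)
  then show "z \<in> {z. z ^ m = 1}" by (simp add: z X_power)
next
  fix z :: complex assume "z \<in> {z. z ^ m = 1}"
  then have z: "z ^ m = 1" by simp
  then have z0: "z \<noteq> 0" using m_pos by (auto simp: power_0_left)
  define \<chi> where "\<chi> = (\<lambda>u\<in>U. z ^ dlog u)"
  have "\<chi> \<in> hom (Fp_units p) Complex_units"
    unfolding hom_def carrier_Fp_units mult_Fp_units
  proof (intro CollectI conjI ballI)
    show "\<chi> \<in> U \<rightarrow> carrier Complex_units"
      using z0 by (auto simp: \<chi>_def Complex_units_def)
    fix x y assume xy: "x \<in> U" "y \<in> U"
    then have nd: "\<not> int p dvd x" "\<not> int p dvd y" by (auto simp only: dest!: not_dvd_U)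
    then have "x * y mod int p \<in> U" by (intro mod_in_U) (simp add: dvd_mult_iff)
    moreover have *: "[x * y mod int p = int g ^ (dlog x + dlog y)] (mod int p)"
      unfolding power_add using cong_mult[OF dlog_cong[OF nd(1)] dlog_cong[OF nd(2)]] by (simp add: cong_def)
    ultimately show "\<chi> (x * y mod int p) = \<chi> x \<otimes>\<^bsub>Complex_units\<^esub> \<chi> y"
      using power_dlog_eq[OF z *] xy by (simp add: \<chi>_def Complex_units_def power_add)
  qed
  moreover have "\<chi> \<in> extensional (carrier (Fp_units p))"
    unfolding carrier_Fp_units by (simp add: \<chi>_def)
  \<comment> \<open>Elements of \<open>H\<close> have logarithms divisible by m, and z^m =
    1.\<close>
  moreover have "\<chi> a = 1" if a: "a \<in> H" for a
  proof -
    have aU: "a \<in> U" using a H_subset_U by blast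
    obtain i where i: "[a = int g ^ i] (mod int p)" using power_g_exists[OF not_dvd_U[OF aU]] .
    then have "int g ^ i mod int p \<in> H" using a mod_U[OF aU] by (simp add: cong_def)
    then obtain j where "i = m * j" by (auto simp only: power_g_mem_H_iff dvd_def)
    then show ?thesis using aU power_dlog_eq[OF z i] by (simp add: \<chi>_def power_mult z)
  qed
  ultimately have "\<chi> \<in> characters_mod_index p m"
    by (simp only: characters_mod_index_def mult_characters_def) blast
  moreover have "char_int p \<chi> (int g) = z"
  proof -
    have nd: "\<not> int p dvd int g" using not_dvd_power_g[of 1] by simp
    have "[int g mod int p = int g ^ 1] (mod int p)" by (simp add: cong_def)
    from power_dlog_eq[OF z this] have "z ^ dlog (int g mod int p) = z" by simp
    then show ?thesis using nd mod_in_U[OF nd] by (simp add: char_int_def \<chi>_def)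
  qed
  ultimately show "z \<in> (\<lambda>\<chi>. char_int p \<chi> (int g)) ` characters_mod_index p m" by blast
qed

lemma finite_characters: "finite (characters_mod_index p m)"
  using bij_betw_finite[OF bij_betw_characters] finite_roots_unity[of m] m_pos by simp

text \<open>With u = g^i the sum becomes the sum of i-th powers of the m-th roots of unity, and m
  divides i exactly when u lies in \<open>H\<close>.\<close>

lemma character_orthogonality:
  assumes "\<not> int p dvd u"
  shows "(\<Sum>\<chi>\<in>characters_mod_index p m. char_int p \<chi> u) = (if u mod int p \<in> H then of_nat m else 0)"
proof -
  obtain i where i: "[u = int g ^ i] (mod int p)" using power_g_exists[OF assms] .
  have "(\<Sum>\<chi>\<in>characters_mod_index p m. char_int p \<chi> u) =
      (\<Sum>\<chi>\<in>characters_mod_index p m. char_int p \<chi> (int g) ^ i)"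
  proof (rule sum.cong)
    fix \<chi> assume "\<chi> \<in> characters_mod_index p m"
    then interpret mod_character p \<chi> by (rule mod_index_character)
    show "char_int p \<chi> u = char_int p \<chi> (int g) ^ i" using X_cong[OF i] by (simp only: X_power)
  qed simp
  also have "\<dots> = (\<Sum>z\<in>{z. z ^ m = 1}. z ^ i)"
    by (rule sum.reindex_bij_betw[OF bij_betw_characters])
  also have "\<dots> = (\<Sum>k<m. cis (2 * pi * real k / real m) ^ i)"
    by (rule sum.reindex_bij_betw[OF bij_betw_roots_unity[OF m_pos], symmetric])
  also have "\<dots> = (\<Sum>k<m. cis (2 * pi * of_int (int i * int k) / of_nat m))"
    by (simp add: DeMoivre mult_ac)
  also have "\<dots> = (if int m dvd int i then of_nat m else 0)"
    by (rule sum_cis_multiple_2pi[OF m_pos])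
  also have "int m dvd int i \<longleftrightarrow> u mod int p \<in> H"
    using i power_g_mem_H_iff[of i] by (simp add: cong_def)
  finally show ?thesis .
qed

text \<open>The direct choice h = c u would leave s(h u^(-1), p). Taking h = (c u)^(-1), again in
  \<open>H\<close>, gives h u = c^(-1) modulo p, and inversion symmetry returns s(c, p).\<close>

lemma sum_dedekind_coset:
  assumes u: "\<not> int p dvd u"
  shows "(\<Sum>c\<in>U. if c * u mod int p \<in> H then dedekind_sum c p else 0) =
    (\<Sum>h\<in>H. dedekind_sum (h * u) p)"
proof -
  \<comment> \<open>The inverse is chosen inside \<open>U\<close>, so that congruent values are
    equal.\<close>
  define iv where "iv a = (SOME b. b \<in> U \<and> [a * b = 1] (mod int p))" for a
  have iv: "iv a \<in> U" "[a * iv a = 1] (mod int p)" if "\<not> int p dvd a" for a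
    using someI_ex[of "\<lambda>b. b \<in> U \<and> [a * b = 1] (mod int p)"] inverse_mod_exists[OF that]
    unfolding iv_def by blast+
  have pow: "[y ^ d = 1] (mod int p)" if "[x * y = 1] (mod int p)" "[x ^ d = 1] (mod int p)" for x y
  proof -
    have "[x ^ d * y ^ d = 1] (mod int p)" using cong_pow[OF that(1), of d] by (simp add: power_mult_distrib)
    moreover have "[x ^ d * y ^ d = 1 * y ^ d] (mod int p)" by (rule cong_mult[OF that(2) cong_refl])
    ultimately show ?thesis by (metis cong_sym cong_trans mult_1)
  qed
  have nd: "\<not> int p dvd c * u" if "c \<in> U" for c
    using u not_dvd_U[OF that] by (simp add: dvd_mult_iff)
  \<comment> \<open>The map c -> (c u)^(-1) is an involution, so one formula gives the bijection in
    both directions.\<close>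
  have invol: "iv (iv (c * u) * u) = c" if c: "c \<in> U" for c
  proof -
    define b where "b = iv (c * u)"
    have b: "b \<in> U" "[c * u * b = 1] (mod int p)" using iv[OF nd[OF c]] by (simp_all only: b_def)
    have iv': "iv (b * u) \<in> U" "[b * u * iv (b * u) = 1] (mod int p)" using iv[OF nd[OF b(1)]] .
    have "[c * (b * u * iv (b * u)) = c * 1] (mod int p)" by (rule cong_mult[OF cong_refl iv'(2)])
    moreover have "[c * u * b * iv (b * u) = 1 * iv (b * u)] (mod int p)" by (rule cong_mult[OF b(2) cong_refl])
    ultimately have "[iv (b * u) = c] (mod int p)" by (simp add: mult_ac) (metis cong_sym cong_trans)
    then show ?thesis using mod_U[OF c] mod_U[OF iv'(1)] by (simp only: cong_def b_def)
  qed
  have "(\<Sum>c\<in>U. if c * u mod int p \<in> H then dedekind_sum c p else 0) =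
      (\<Sum>c\<in>{c\<in>U. c * u mod int p \<in> H}. dedekind_sum c p)"
    by (rule sum.inter_filter[symmetric]) simp
  also have "\<dots> = (\<Sum>h\<in>H. dedekind_sum (h * u) p)"
  proof (rule sum.reindex_bij_witness[of _ "\<lambda>h. iv (h * u)" "\<lambda>c. iv (c * u)"])
    fix c assume "c \<in> {c\<in>U. c * u mod int p \<in> H}"
    then have c: "c \<in> U" "[(c * u) ^ d = 1] (mod int p)" by (auto simp only: mod_mem_H_iff)
    show "iv (iv (c * u) * u) = c" by (rule invol[OF c(1)])
    show "iv (c * u) \<in> H"
      using pow[OF iv(2)[OF nd[OF c(1)]] c(2)] iv(1)[OF nd[OF c(1)]] unfolding mem_H_iff by blast
    have "[(iv (c * u) * u) * c = 1] (mod int p)" using iv(2)[OF nd[OF c(1)]] by (simp add: mult_ac)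
    then show "dedekind_sum (iv (c * u) * u) p = dedekind_sum c p" by (rule dedekind_sum_inverse)
  next
    fix h assume "h \<in> H"
    then have h: "h \<in> U" "[h ^ d = 1] (mod int p)" by (simp_all only: mem_H_iff)
    show "iv (iv (h * u) * u) = h" by (rule invol[OF h(1)])
    have "[h * (iv (h * u) * u) = 1] (mod int p)" using iv(2)[OF nd[OF h(1)]] by (simp add: mult_ac)
    then have "[(iv (h * u) * u) ^ d = 1] (mod int p)" by (rule pow[OF _ h(2)])
    then show "iv (h * u) \<in> {c\<in>U. c * u mod int p \<in> H}"
      using iv(1)[OF nd[OF h(1)]] nd unfolding mod_mem_H_iff by blast
  qed
  finally show ?thesis .
qed

end

section \<open>Moments\<close>

context prime_index
begin

text \<open>This is D(chi), kept complex because it is multiplied by character values. By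
  \<open>dedekind_character_sum\<close> it is a nonnegative real for every character, so its powers
  need no absolute value.\<close>

definition dedekind_transform :: "(int \<Rightarrow> complex) \<Rightarrow> complex"
  where "dedekind_transform \<chi> = (\<Sum>c\<in>U. char_int p \<chi> c * of_real (dedekind_sum c p))"

lemma L_one_power_eq:
  assumes "\<chi> \<in> odd_characters_mod_index p m"
  shows "complex_of_real (cmod (L_one p \<chi>) ^ (2 * k)) =
    of_real ((pi\<^sup>2 / real p) ^ k) * dedekind_transform \<chi> ^ k"
proof -
  interpret mod_character p \<chi>
    using assms by (intro mod_index_character) (simp add: odd_characters_mod_index_def)
  interpret odd_mod_character p \<chi>
    by unfold_locales (use assms in \<open>simp add: odd_characters_mod_index_def\<close>)
  have "cmod (L_one p \<chi>) ^ (2 * k) = (pi\<^sup>2 / real p) ^ k * ((norm saw_sum)\<^sup>2) ^ k"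
    by (simp only: power_mult norm_L_one_square power_mult_distrib)
  then show ?thesis
    by (simp only: dedekind_transform_def dedekind_character_sum of_real_mult of_real_power)
qed

lemma sum_L_one_power:
  assumes "k \<ge> 1"
  shows "complex_of_real (\<Sum>\<chi>\<in>odd_characters_mod_index p m. cmod (L_one p \<chi>) ^ (2 * k)) =
    of_real ((pi\<^sup>2 / real p) ^ k) * (\<Sum>\<chi>\<in>characters_mod_index p m. dedekind_transform \<chi> ^ k)"
proof -
  have "dedekind_transform \<chi> ^ k = 0"
    if "\<chi> \<in> characters_mod_index p m - odd_characters_mod_index p m" for \<chi>
  proof -
    interpret mod_character p \<chi> using that by (intro mod_index_character) blast
    have "X (-1) = 1" using that X_minus_1 by (auto simp: odd_characters_mod_index_def)
    then have "dedekind_transform \<chi> = 0"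
      unfolding dedekind_transform_def by (rule even_dedekind_character_sum)
    \<comment> \<open>Here \<open>k \<ge> 1\<close> enters, since 0^0 = 1.\<close>
    then show ?thesis using assms by (simp only:) (simp add: power_0_left)
  qed
  then have "(\<Sum>\<chi>\<in>odd_characters_mod_index p m. dedekind_transform \<chi> ^ k) =
      (\<Sum>\<chi>\<in>characters_mod_index p m. dedekind_transform \<chi> ^ k)"
    by (intro sum.mono_neutral_left finite_characters)
      (auto simp only: odd_characters_mod_index_def)
  then show ?thesis
    by (simp only: of_real_sum L_one_power_eq sum_distrib_left[symmetric] cong: sum.cong)
qed

text \<open>This treats the last factor of D(chi)^k: u will be the product of the variables of the
  other k - 1 factors, so one use of orthogonality, at c u, is enough.\<close>

lemma sum_character_dedekind:
  assumes "\<not> int p dvd u"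
  shows "(\<Sum>\<chi>\<in>characters_mod_index p m. char_int p \<chi> u * dedekind_transform \<chi>) =
    of_nat m * of_real (\<Sum>h\<in>H. dedekind_sum (h * u) p)"
proof -
  have "(\<Sum>\<chi>\<in>characters_mod_index p m. char_int p \<chi> u * dedekind_transform \<chi>) =
      (\<Sum>\<chi>\<in>characters_mod_index p m. \<Sum>c\<in>U. char_int p \<chi> (c * u) * of_real (dedekind_sum c p))"
  proof (rule sum.cong)
    fix \<chi> assume "\<chi> \<in> characters_mod_index p m"
    then interpret mod_character p \<chi> by (rule mod_index_character)
    show "X u * dedekind_transform \<chi> = (\<Sum>c\<in>U. X (c * u) * of_real (dedekind_sum c p))"
      unfolding dedekind_transform_def sum_distrib_left by (rule sum.cong) (simp_all only: X_mult mult_ac)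
  qed simp
  also have "\<dots> = (\<Sum>c\<in>U. (\<Sum>\<chi>\<in>characters_mod_index p m. char_int p \<chi> (c * u)) *
      of_real (dedekind_sum c p))"
    by (subst sum.swap) (simp only: sum_distrib_right)
  also have "\<dots> = (\<Sum>c\<in>U. of_nat m * of_real (if c * u mod int p \<in> H then dedekind_sum c p else 0))"
  proof (rule sum.cong)
    fix c assume "c \<in> U"
    then have "\<not> int p dvd c * u" using assms by (auto simp only: dvd_mult_iff dest!: not_dvd_U)
    from character_orthogonality[OF this]
    show "(\<Sum>\<chi>\<in>characters_mod_index p m. char_int p \<chi> (c * u)) * of_real (dedekind_sum c p) =
        of_nat m * of_real (if c * u mod int p \<in> H then dedekind_sum c p else 0)"
      by (simp only: split: if_split) simp
  qed simp
  also have "\<dots> = of_nat m * of_real (\<Sum>h\<in>H. dedekind_sum (h * u) p)"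
    by (simp only: sum_distrib_left[symmetric] of_real_sum[symmetric] sum_dedekind_coset[OF assms])
  finally show ?thesis .
qed

lemma sum_dedekind_transform_power:
  assumes "k \<ge> 1"
  shows "(\<Sum>\<chi>\<in>characters_mod_index p m. dedekind_transform \<chi> ^ k) =
    of_nat m * of_real (\<Sum>h\<in>H. \<Sum>t\<in>{1..k - 1} \<rightarrow>\<^sub>E U.
      (\<Prod>i = 1..k - 1. dedekind_sum (t i) p) * dedekind_sum (h * (\<Prod>i = 1..k - 1. t i)) p)"
proof -
  let ?T = "{1..k - 1} \<rightarrow>\<^sub>E U"
  have "(\<Sum>\<chi>\<in>characters_mod_index p m. dedekind_transform \<chi> ^ k) =
      (\<Sum>\<chi>\<in>characters_mod_index p m. \<Sum>t\<in>?T. of_real (\<Prod>i = 1..k - 1. dedekind_sum (t i) p) *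
        (char_int p \<chi> (\<Prod>i = 1..k - 1. t i) * dedekind_transform \<chi>))"
  proof (rule sum.cong)
    fix \<chi> assume "\<chi> \<in> characters_mod_index p m"
    then interpret mod_character p \<chi> by (rule mod_index_character)
    \<comment> \<open>Only k - 1 factors are expanded into tuples. For k = 1 there is a single empty
      tuple with product 1, which gives the convention that the inner sum is s(h, p).\<close>
    have "dedekind_transform \<chi> ^ k = dedekind_transform \<chi> ^ (k - 1) * dedekind_transform \<chi>"
      by (rule power_minus_mult[symmetric]) (use assms in simp)
    also have "dedekind_transform \<chi> ^ (k - 1) = (\<Prod>i = 1..k - 1. dedekind_transform \<chi>)"
      by (simp only: prod_constant card_atLeastAtMost diff_Suc_1)
    also have "\<dots> = (\<Sum>t\<in>?T. \<Prod>i = 1..k - 1. X (t i) * of_real (dedekind_sum (t i) p))"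
      unfolding dedekind_transform_def by (rule prod_sum_PiE) auto
    finally have "dedekind_transform \<chi> ^ k =
        (\<Sum>t\<in>?T. (\<Prod>i = 1..k - 1. X (t i) * of_real (dedekind_sum (t i) p)) * dedekind_transform \<chi>)"
      by (simp only: sum_distrib_right)
    then show "dedekind_transform \<chi> ^ k = (\<Sum>t\<in>?T. of_real (\<Prod>i = 1..k - 1. dedekind_sum (t i) p) *
        (X (\<Prod>i = 1..k - 1. t i) * dedekind_transform \<chi>))"
      by (simp only: prod.distrib X_prod finite_atLeastAtMost of_real_prod mult_ac)
  qed simp
  also have "\<dots> = (\<Sum>t\<in>?T. of_real (\<Prod>i = 1..k - 1. dedekind_sum (t i) p) *
      (\<Sum>\<chi>\<in>characters_mod_index p m. char_int p \<chi> (\<Prod>i = 1..k - 1. t i) * dedekind_transform \<chi>))"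
    by (subst sum.swap) (simp only: sum_distrib_left)
  also have "\<dots> = (\<Sum>t\<in>?T. of_nat m * of_real (\<Sum>h\<in>H. (\<Prod>i = 1..k - 1. dedekind_sum (t i) p) *
      dedekind_sum (h * (\<Prod>i = 1..k - 1. t i)) p))"
  proof (rule sum.cong)
    fix t assume t: "t \<in> ?T"
    have "\<not> int p dvd t i" if "i \<in> {1..k - 1}" for i
      using PiE_mem[OF t that] by (rule not_dvd_U)
    then have "\<not> int p dvd (\<Prod>i = 1..k - 1. t i)"
      using prime_p by (subst prime_dvd_prod_iff) auto
    from sum_character_dedekind[OF this]
    show "of_real (\<Prod>i = 1..k - 1. dedekind_sum (t i) p) *
        (\<Sum>\<chi>\<in>characters_mod_index p m. char_int p \<chi> (\<Prod>i = 1..k - 1. t i) * dedekind_transform \<chi>) =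
        of_nat m * of_real (\<Sum>h\<in>H. (\<Prod>i = 1..k - 1. dedekind_sum (t i) p) *
          dedekind_sum (h * (\<Prod>i = 1..k - 1. t i)) p)"
      by (simp only: sum_distrib_left[symmetric] of_real_mult mult.left_commute)
  qed simp
  also have "\<dots> = of_nat m * of_real (\<Sum>t\<in>?T. \<Sum>h\<in>H. (\<Prod>i = 1..k - 1. dedekind_sum (t i) p) *
      dedekind_sum (h * (\<Prod>i = 1..k - 1. t i)) p)"
    by (simp only: sum_distrib_left[symmetric] of_real_sum[symmetric])
  also have "\<dots> = of_nat m * of_real (\<Sum>h\<in>H. \<Sum>t\<in>?T. (\<Prod>i = 1..k - 1. dedekind_sum (t i) p) *
      dedekind_sum (h * (\<Prod>i = 1..k - 1. t i)) p)"
    by (subst sum.swap) (rule refl)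
  finally show ?thesis .
qed

end

theorem theorem2p10:
  fixes p m k :: nat
  assumes "prime p" and "m dvd p - 1" and "even m" and "k \<ge> 1"
  shows "L_moment (2 * k) p m =
    2 * pi ^ (2 * k) / real p ^ k *
    (\<Sum>g\<in>index_subgroup p m. \<Sum>t\<in>{1..k - 1} \<rightarrow>\<^sub>E {1..int p - 1}.
       (\<Prod>i = 1..k - 1. dedekind_sum (t i) p) *
       dedekind_sum (g * (\<Prod>i = 1..k - 1. t i)) p)"
    (is "_ = _ * ?S")
proof -
  interpret prime_index p m by unfold_locales (use assms in auto)
  \<comment> \<open>The computation ran over the complex numbers; both sides are real, so
    injectivity of \<open>of_real\<close> brings it back.\<close>
  have "complex_of_real (\<Sum>\<chi>\<in>odd_characters_mod_index p m. cmod (L_one p \<chi>) ^ (2 * k)) =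
      complex_of_real ((pi\<^sup>2 / real p) ^ k * (real m * ?S))"
    by (simp only: sum_L_one_power[OF assms(4)] sum_dedekind_transform_power[OF assms(4)]
        of_real_mult of_real_of_nat_eq)
  then have "(\<Sum>\<chi>\<in>odd_characters_mod_index p m. cmod (L_one p \<chi>) ^ (2 * k)) =
      (pi\<^sup>2 / real p) ^ k * (real m * ?S)"
    by (simp only: of_real_eq_iff)
  then have "L_moment (2 * k) p m = 2 / real m * ((pi\<^sup>2 / real p) ^ k * (real m * ?S))"
    by (simp only: L_moment_def)
  also have "\<dots> = 2 * pi ^ (2 * k) / real p ^ k * ?S"
    using m_pos by (simp add: power_divide power_mult)
  finally show ?thesis .
qed

end
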